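(* Let $t$ be a positive integer and let $H$ be a Hadamard matrix of order $8t$ such that every quadruple of distinct rows of $H$ has type $0$ or $t$. Then $H$ is equivalent to the Sylvester Hadamard matrix of order $8t$ (in particular, $8t$ is a power of $2$).
   Context: A Hadamard matrix of order $n$ is an $n\times n$ matrix $H=(h_{uv})$ with entries in $\{-1,1\}$ such that $HH^\top=nI$. For four distinct rows $i,j,k,\ell$ of $H$, put $P_{ijk\ell}=\left|\sum_{r=1}^n h_{ir}h_{jr}h_{kr}h_{\ell r}\right|$; the type of the quadruple $\{i,j,k,\ell\}$ is $T_{ijk\ell}=\frac{n-P_{ijk\ell}}{8}$. Two Hadamard matrices are equivalent if one can be obtained from the other by a sequence of row negations, row permutations, column negations and column permutations. The Sylvester Hadamard matrices are defined by $\mathsf{H}_1=[1]$ and $\mathsf{H}_{2^r}=\begin{bmatrix}\mathsf{H}_{2^{r-1}}&\mathsf{H}_{2^{r-1}}\\ \mathsf{H}_{2^{r-1}}&-\mathsf{H}_{2^{r-1}}\end{bmatrix}$ for $r\geqslant1$. *)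

theory Defs
  imports
    "Jordan_Normal_Form.Column_Operations"
    "HOL-Combinatorics.Permutations"
begin

definition hadamard_mat :: "nat \<Rightarrow> int mat \<Rightarrow> bool" where
  "hadamard_mat n H \<longleftrightarrow>
     H \<in> carrier_mat n n \<and>
     (\<forall>u<n. \<forall>v<n. H $$ (u, v) \<in> {- 1, 1}) \<and>
     H * transpose_mat H = int n \<cdot>\<^sub>m 1\<^sub>m n"

definition quad_profile :: "int mat \<Rightarrow> nat \<Rightarrow> nat \<Rightarrow> nat \<Rightarrow> nat \<Rightarrow> int" where
  "quad_profile H i j k l =
     \<bar>\<Sum>r<dim_col H. H $$ (i, r) * H $$ (j, r) * H $$ (k, r) * H $$ (l, r)\<bar>"

text \<open>The type is taken in the rationals, so that the division by 8 is exact.\<close>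

definition quad_type :: "int mat \<Rightarrow> nat \<Rightarrow> nat \<Rightarrow> nat \<Rightarrow> nat \<Rightarrow> rat" where
  "quad_type H i j k l = (of_nat (dim_col H) - of_int (quad_profile H i j k l)) / 8"

inductive hadamard_step :: "int mat \<Rightarrow> int mat \<Rightarrow> bool" where
  negate_row: "i < dim_row A \<Longrightarrow> hadamard_step A (multrow i (- 1) A)"
| permute_rows: "p permutes {..<dim_row A} \<Longrightarrow>
    hadamard_step A (mat (dim_row A) (dim_col A) (\<lambda>(u, v). A $$ (p u, v)))"
| negate_col: "j < dim_col A \<Longrightarrow> hadamard_step A (multcol j (- 1) A)"
| permute_cols: "p permutes {..<dim_col A} \<Longrightarrow>
    hadamard_step A (mat (dim_row A) (dim_col A) (\<lambda>(u, v). A $$ (u, p v)))"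

text \<open>Every step can be undone by a step, so this closure is also symmetric.\<close>

definition hadamard_equiv :: "int mat \<Rightarrow> int mat \<Rightarrow> bool" where
  "hadamard_equiv = hadamard_step\<^sup>*\<^sup>*"

text \<open>The argument is the exponent: \<open>sylvester r\<close> has order \<open>2 ^ r\<close>.\<close>

primrec sylvester :: "nat \<Rightarrow> int mat" where
  "sylvester 0 = mat 1 1 (\<lambda>_. 1)"
| "sylvester (Suc r) =
     four_block_mat (sylvester r) (sylvester r) (sylvester r) (- sylvester r)"

end

theory Submission
  imports Defs "Jordan_Normal_Form.Determinant"
begin

text \<open>
  For distinct rows \<open>i, j, k\<close> the product \<open>v = r\<^sub>i r\<^sub>j r\<^sub>k\<close> is nonzero, so, the rows being a
  basis, some row \<open>l\<close> is not orthogonal to it; the type condition then forces \<open>v = \<plusminus> r\<^sub>l\<close>. Hence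
  after normalising the first row to \<open>1\<close> the rows form, up to sign, an elementary abelian
  2-group. Choosing generators one at a time identifies a growing set of \<open>2 ^ k\<close> rows with the
  rows of \<open>sylvester k\<close>: the signs of the \<open>k\<close> generators at a column \<open>c\<close> are the binary digits of
  a column index \<open>w c\<close> of \<open>sylvester k\<close>. When all rows are used up, orthogonality of columns
  makes \<open>w\<close> a permutation.
\<close>

section \<open>Sylvester matrices: block entries and closure of rows under products\<close>

lemma sylvester_carrier [simp]: "sylvester r \<in> carrier_mat (2 ^ r) (2 ^ r)"
proof (induction r)
  case (Suc r)
  then have "four_block_mat (sylvester r) (sylvester r) (sylvester r) (- sylvester r)
      \<in> carrier_mat (2 ^ r + 2 ^ r) (2 ^ r + 2 ^ r)"
    by (intro four_block_carrier_mat) auto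
  then show ?case by (simp add: mult_2)
qed simp

lemma sylvester_dim [simp]: "dim_row (sylvester r) = 2 ^ r" "dim_col (sylvester r) = 2 ^ r"
  using sylvester_carrier[of r] by (auto simp del: sylvester_carrier)

lemma sylvester_Suc_index:
  assumes "u < 2 ^ r" "v < 2 ^ r"
  shows "sylvester (Suc r) $$ (u, v) = sylvester r $$ (u, v)"
    and "sylvester (Suc r) $$ (u, v + 2 ^ r) = sylvester r $$ (u, v)"
    and "sylvester (Suc r) $$ (u + 2 ^ r, v) = sylvester r $$ (u, v)"
    and "sylvester (Suc r) $$ (u + 2 ^ r, v + 2 ^ r) = - sylvester r $$ (u, v)"
  using assms by auto

declare sylvester.simps(2) [simp del]

lemma less_power_Suc_cases:
  fixes u :: nat
  assumes "u < 2 ^ Suc r"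
  obtains "u < 2 ^ r" | u' where "u' < 2 ^ r" "u = u' + 2 ^ r"
proof (cases "u < 2 ^ r")
  case False
  with assms that(2)[of "u - 2 ^ r"] show ?thesis by simp
qed (use that in auto)

text \<open>The rows are the characters of an elementary abelian 2-group. In the induction every row
  is a row of the half-size matrix followed by itself or its negative, and these two signs
  multiply.\<close>

lemma sylvester_rows_closed:
  assumes "u < 2 ^ r" "u' < 2 ^ r"
  shows "\<exists>x<2 ^ r. \<forall>v<2 ^ r.
    sylvester r $$ (u, v) * sylvester r $$ (u', v) = sylvester r $$ (x, v)"
  using assms
proof (induction r arbitrary: u u')
  case (Suc r)
  have "\<exists>y<2 ^ r. \<exists>y'<2 ^ r. (u = y \<or> u = y + 2 ^ r) \<and> (u' = y' \<or> u' = y' + 2 ^ r)"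
    using Suc.prems by (metis less_power_Suc_cases)
  then obtain y y' where y: "y < 2 ^ r" "y' < 2 ^ r"
    "u = y \<or> u = y + 2 ^ r" "u' = y' \<or> u' = y' + 2 ^ r" by blast
  obtain x where x: "x < 2 ^ r" and
    eq: "\<And>v. v < 2 ^ r \<Longrightarrow>
      sylvester r $$ (y, v) * sylvester r $$ (y', v) = sylvester r $$ (x, v)"
    using Suc.IH[OF y(1,2)] by blast
  \<comment> \<open>Lower rows change sign on the right half; the changes cancel exactly when both
    factors are upper or both are lower.\<close>
  define z where "z = (if (u = y) = (u' = y') then x else x + 2 ^ r)"
  have "sylvester (Suc r) $$ (u, v) * sylvester (Suc r) $$ (u', v) = sylvester (Suc r) $$ (z, v)"
    if "v < 2 ^ Suc r" for v
    using that
  proof (cases rule: less_power_Suc_cases)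
    case 1
    with y(3,4) show ?thesis
      using x y(1,2) eq[of v] by (elim disjE) (simp_all add: z_def sylvester_Suc_index)
  next
    case (2 v')
    with y(3,4) show ?thesis
      using x y(1,2) eq[of v'] by (elim disjE) (simp_all add: z_def sylvester_Suc_index)
  qed
  moreover have "z < 2 ^ Suc r" using x by (simp add: z_def)
  ultimately show ?case by blast
qed simp

section \<open>Equivalence through signed permutations\<close>

lemma hadamard_equiv_trans [trans]:
  "hadamard_equiv A B \<Longrightarrow> hadamard_equiv B C \<Longrightarrow> hadamard_equiv A C"
  by (simp add: hadamard_equiv_def)

lemma hadamard_equiv_step: "hadamard_step A B \<Longrightarrow> hadamard_equiv A B"
  by (simp add: hadamard_equiv_def)

lemma hadamard_equiv_sign_rows:
  assumes A: "A \<in> carrier_mat n m" and a: "\<And>u. u < n \<Longrightarrow> a u \<in> {- 1, 1 :: int}"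
  shows "hadamard_equiv A (mat n m (\<lambda>(u, v). a u * A $$ (u, v)))"
proof -
  \<comment> \<open>Only the first \<open>k\<close> rows have received their sign, so consecutive
    stages differ by at most one negation.\<close>
  define B where "B k = mat n m (\<lambda>(u, v). (if u < k then a u else 1) * A $$ (u, v))" for k
  have "hadamard_equiv A (B k)" if "k \<le> n" for k
    using that
  proof (induction k)
    case 0
    have "B 0 = A" using A by (intro eq_matI) (auto simp: B_def)
    then show ?case by (simp add: hadamard_equiv_def)
  next
    case (Suc k)
    then have IH: "hadamard_equiv A (B k)" by simp
    have "B (Suc k) = (if a k = 1 then B k else multrow k (- 1) (B k))"
      using a[of k] Suc.prems by (intro eq_matI) (auto simp: B_def less_Suc_eq)
    moreover have "hadamard_step (B k) (multrow k (- 1) (B k))"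
      using Suc.prems by (intro negate_row) (simp add: B_def)
    ultimately show ?case
      using IH by (auto intro: hadamard_equiv_trans hadamard_equiv_step)
  qed
  from this[of n] have "hadamard_equiv A (B n)" by simp
  also have "B n = mat n m (\<lambda>(u, v). a u * A $$ (u, v))"
    by (intro eq_matI) (auto simp: B_def)
  finally show ?thesis .
qed

lemma hadamard_equiv_sign_cols:
  assumes A: "A \<in> carrier_mat n m" and b: "\<And>v. v < m \<Longrightarrow> b v \<in> {- 1, 1 :: int}"
  shows "hadamard_equiv A (mat n m (\<lambda>(u, v). b v * A $$ (u, v)))"
proof -
  define B where "B k = mat n m (\<lambda>(u, v). (if v < k then b v else 1) * A $$ (u, v))" for k
  have "hadamard_equiv A (B k)" if "k \<le> m" for k
    using that
  proof (induction k)
    case 0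
    have "B 0 = A" using A by (intro eq_matI) (auto simp: B_def)
    then show ?case by (simp add: hadamard_equiv_def)
  next
    case (Suc k)
    then have IH: "hadamard_equiv A (B k)" by simp
    have "B (Suc k) = (if b k = 1 then B k else multcol k (- 1) (B k))"
      using b[of k] Suc.prems by (intro eq_matI) (auto simp: B_def less_Suc_eq)
    moreover have "hadamard_step (B k) (multcol k (- 1) (B k))"
      using Suc.prems by (intro negate_col) (simp add: B_def)
    ultimately show ?case
      using IH by (auto intro: hadamard_equiv_trans hadamard_equiv_step)
  qed
  from this[of m] have "hadamard_equiv A (B m)" by simp
  also have "B m = mat n m (\<lambda>(u, v). b v * A $$ (u, v))"
    by (intro eq_matI) (auto simp: B_def)
  finally show ?thesis .
qed

text \<open>Permutations are carried out before the signs, which is why \<open>a\<close> and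
  \<open>b\<close> are indexed by positions in \<open>K\<close> and not in \<open>A\<close>.\<close>

lemma hadamard_equiv_signed_permutations:
  assumes A: "A \<in> carrier_mat n m" and K: "K \<in> carrier_mat n m"
    and p: "bij_betw p {..<n} {..<n}" and q: "bij_betw q {..<m} {..<m}"
    and a: "\<And>u. u < n \<Longrightarrow> a u \<in> {- 1, 1 :: int}"
    and b: "\<And>v. v < m \<Longrightarrow> b v \<in> {- 1, 1 :: int}"
    and eq: "\<And>u v. u < n \<Longrightarrow> v < m \<Longrightarrow> K $$ (u, v) = a u * b v * A $$ (p u, q v)"
  shows "hadamard_equiv A K"
proof -
  \<comment> \<open>\<open>permutes\<close> demands the identity outside the index range, about
    which \<open>bij_betw\<close> says nothing.\<close>
  define p' where "p' u = (if u < n then p u else u)" for u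
  define q' where "q' v = (if v < m then q v else v)" for v
  have "bij_betw p' {..<n} {..<n}"
    using p by (subst bij_betw_cong[where g = p]) (auto simp: p'_def)
  then have p': "p' permutes {..<n}"
    by (rule bij_imp_permutes) (simp add: p'_def)
  have "bij_betw q' {..<m} {..<m}"
    using q by (subst bij_betw_cong[where g = q]) (auto simp: q'_def)
  then have q': "q' permutes {..<m}"
    by (rule bij_imp_permutes) (simp add: q'_def)
  have bounds: "p' u < n" "q' v < m" if "u < n" "v < m" for u v
    using that p q by (auto simp: p'_def q'_def bij_betw_def)
  define B where "B = mat n m (\<lambda>(u, v). A $$ (p' u, v))"
  define C where "C = mat n m (\<lambda>(u, v). B $$ (u, q' v))"
  define D where "D = mat n m (\<lambda>(u, v). a u * C $$ (u, v))"
  have "hadamard_equiv A B"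
    using permute_rows[of p' A] A p' by (auto simp: B_def intro!: hadamard_equiv_step)
  also have "hadamard_equiv B C"
    using permute_cols[of q' B] q' by (auto simp: B_def C_def intro!: hadamard_equiv_step)
  also have "hadamard_equiv C D"
    unfolding D_def by (rule hadamard_equiv_sign_rows) (use a in \<open>auto simp: C_def\<close>)
  also have "hadamard_equiv D (mat n m (\<lambda>(u, v). b v * D $$ (u, v)))"
    by (rule hadamard_equiv_sign_cols) (use b in \<open>auto simp: D_def\<close>)
  also have "mat n m (\<lambda>(u, v). b v * D $$ (u, v)) = K"
    using K bounds by (intro eq_matI) (auto simp: B_def C_def D_def p'_def q'_def eq)
  finally show ?thesis .
qed

section \<open>Orthogonality of rows and columns, and sign arithmetic\<close>

lemma hadamard_row_orthogonal:
  assumes "hadamard_mat n H" "i < n" "j < n"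
  shows "(\<Sum>c<n. H $$ (i, c) * H $$ (j, c)) = (if i = j then int n else 0)"
proof -
  have H: "H \<in> carrier_mat n n" and eq: "H * transpose_mat H = int n \<cdot>\<^sub>m 1\<^sub>m n"
    using assms by (auto simp: hadamard_mat_def)
  have "(H * transpose_mat H) $$ (i, j) = (\<Sum>c<n. H $$ (i, c) * H $$ (j, c))"
    using H assms by (auto simp: scalar_prod_def lessThan_atLeast0)
  then show ?thesis using assms by (auto simp: eq)
qed

text \<open>The transpose divided by \<open>n\<close> is a right inverse, hence also a left inverse,
  as the matrix is square. The division is the reason for passing to the rationals.\<close>

lemma hadamard_col_orthogonal:
  assumes "hadamard_mat n H" "c < n" "d < n"
  shows "(\<Sum>i<n. H $$ (i, c) * H $$ (i, d)) = (if c = d then int n else 0)"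
proof -
  have H: "H \<in> carrier_mat n n"
    using assms by (auto simp: hadamard_mat_def)
  define A where "A = mat n n (\<lambda>(i, c). rat_of_int (H $$ (i, c)))"
  define B where "B = mat n n (\<lambda>(c, i). rat_of_int (H $$ (i, c)) / of_nat n)"
  have "A * B = 1\<^sub>m n"
  proof (rule eq_matI)
    fix i j assume ij: "i < dim_row (1\<^sub>m n :: rat mat)" "j < dim_col (1\<^sub>m n :: rat mat)"
    then have "(A * B) $$ (i, j) = of_int (\<Sum>c<n. H $$ (i, c) * H $$ (j, c)) / of_nat n"
      by (auto simp: A_def B_def scalar_prod_def lessThan_atLeast0 sum_divide_distrib)
    also have "\<dots> = 1\<^sub>m n $$ (i, j)"
      using ij assms by (subst hadamard_row_orthogonal) auto
    finally show "(A * B) $$ (i, j) = 1\<^sub>m n $$ (i, j)" .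
  qed (auto simp: A_def B_def)
  then have "B * A = 1\<^sub>m n"
    by (intro mat_mult_left_right_inverse[of A n B]) (auto simp: A_def B_def)
  moreover have "(B * A) $$ (c, d) = of_int (\<Sum>i<n. H $$ (i, c) * H $$ (i, d)) / of_nat n"
    using assms by (auto simp: A_def B_def scalar_prod_def lessThan_atLeast0 sum_divide_distrib)
  ultimately have "rat_of_int (\<Sum>i<n. H $$ (i, c) * H $$ (i, d)) / of_nat n = of_bool (c = d)"
    using assms by auto
  then have "rat_of_int (\<Sum>i<n. H $$ (i, c) * H $$ (i, d)) = of_int (if c = d then int n else 0)"
    using assms by (auto simp: field_simps split: if_splits)
  then show ?thesis by (simp only: of_int_eq_iff)
qed

text \<open>With \<open>s\<close> the sign of the sum, the terms \<open>1 - s * x c\<close> are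
  nonnegative and add up to zero, so each vanishes.\<close>

lemma signs_constant_if_abs_sum_eq:
  fixes x :: "nat \<Rightarrow> int"
  assumes x: "\<And>c. c < n \<Longrightarrow> x c \<in> {- 1, 1}" and "\<bar>\<Sum>c<n. x c\<bar> = int n"
  shows "\<exists>s\<in>{- 1, 1}. \<forall>c<n. x c = s"
proof -
  obtain s where s: "s \<in> {- 1, 1 :: int}" "(\<Sum>c<n. x c) = s * int n"
  proof -
    have "(\<Sum>c<n. x c) = 1 * int n \<or> (\<Sum>c<n. x c) = - 1 * int n"
      using assms(2) by linarith
    then show ?thesis using that by blast
  qed
  have "(\<Sum>c<n. 1 - s * x c) = int n - s * (\<Sum>c<n. x c)"
    by (simp add: sum_subtractf sum_distrib_left)
  also have "\<dots> = 0" using s by auto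
  finally have "\<forall>c\<in>{..<n}. 1 - s * x c = 0"
    using s(1) x by (subst (asm) sum_nonneg_eq_0_iff) fastforce+
  then show ?thesis using s(1) by force
qed

text \<open>One column of the argument that a new row cannot be generated by old ones:
  \<open>f\<close> is the entry of row 0, \<open>x\<close>, \<open>y\<close>, \<open>z\<close> those
  of three old rows, \<open>m\<close> that of the new row. The second relation gives
  \<open>m = s * f * x * y\<close>, and the first turns \<open>f * x * y\<close> into
  \<open>a * b * d * z\<close>.\<close>

lemma product_relation_cancel:
  fixes f x y z m a b d s :: int
  assumes "a * f * x * (b * f * y) = d * f * z" "f * x * m = s * y"
    and "f * f = 1" "x * x = 1" "a * a = 1" "b * b = 1"
  shows "m = s * a * b * d * z"
proof -
  have "m = (f * f) * (x * x) * m" using assms by simp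
  also have "\<dots> = f * x * (f * x * m)" by (simp add: ac_simps)
  also have "\<dots> = s * (a * a) * (b * b) * (f * f) * (f * x * y)" using assms by simp
  also have "\<dots> = s * a * b * f * (a * f * x * (b * f * y))" by (simp add: ac_simps)
  also have "\<dots> = s * a * b * (f * f) * d * z" unfolding assms(1) by (simp add: ac_simps)
  finally show ?thesis using assms by simp
qed

section \<open>Closure of the rows under triple products, up to sign\<close>

locale extremal_quadruples =
  fixes n :: nat and H :: "int mat"
  assumes hadamard: "hadamard_mat n H"
    and pos: "0 < n"
    and quad: "\<And>i j k l. \<lbrakk>i < n; j < n; k < n; l < n; distinct [i, j, k, l]\<rbrakk>
           \<Longrightarrow> quad_profile H i j k l \<in> {0, int n}"
begin

abbreviation h :: "nat \<Rightarrow> nat \<Rightarrow> int" where "h i c \<equiv> H $$ (i, c)"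

lemma dims [simp]: "dim_row H = n" "dim_col H = n"
  using hadamard by (auto simp: hadamard_mat_def)

lemma sign: "i < n \<Longrightarrow> c < n \<Longrightarrow> h i c \<in> {- 1, 1}"
  using hadamard by (auto simp: hadamard_mat_def)

lemma sign_square [simp]: "i < n \<Longrightarrow> c < n \<Longrightarrow> h i c * h i c = 1"
  using sign[of i c] by auto

text \<open>Proportional rows have inner product \<open>s * n\<close>, which is nonzero, whereas
  distinct rows are orthogonal.\<close>

lemma row_eq_if_proportional:
  assumes "i < n" "j < n" "s \<noteq> 0" "\<And>c. c < n \<Longrightarrow> h i c = s * h j c"
  shows "i = j"
proof (rule ccontr)
  assume "i \<noteq> j"
  then have "0 = (\<Sum>c<n. h i c * h j c)"
    using hadamard_row_orthogonal[OF hadamard, of i j] assms by simp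
  also have "\<dots> = (\<Sum>c<n. s)" using assms by (intro sum.cong) (auto simp: mult.assoc)
  finally show False using assms pos by simp
qed

text \<open>The rows span: by column orthogonality, combining the rows with the inner products as
  coefficients returns \<open>n * x c\<close> at column \<open>c\<close>.\<close>

lemma nonorthogonal_row:
  assumes "c < n" "x c \<noteq> 0"
  shows "\<exists>l<n. (\<Sum>d<n. x d * h l d) \<noteq> 0"
proof (rule ccontr)
  assume "\<not> ?thesis"
  then have "0 = (\<Sum>l<n. h l c * (\<Sum>d<n. x d * h l d))" by simp
  also have "\<dots> = (\<Sum>d<n. x d * (\<Sum>l<n. h l c * h l d))"
    unfolding sum_distrib_left by (subst sum.swap) (simp add: ac_simps)
  also have "\<dots> = (\<Sum>d<n. if c = d then x d * int n else 0)"
    using assms by (intro sum.cong) (auto simp: hadamard_col_orthogonal[OF hadamard])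
  also have "\<dots> = x c * int n" using assms by simp
  finally show False using assms pos by simp
qed

text \<open>This is where the condition on quadruples enters: a row not orthogonal to the product
  has nonzero profile with \<open>i\<close>, \<open>j\<close>, \<open>k\<close>, so the profile is
  \<open>n\<close> and the product is that row up to sign. If two indices coincide, their entries
  cancel and the third row remains.\<close>

lemma triple_product_row:
  assumes "i < n" "j < n" "k < n"
  shows "\<exists>l<n. \<exists>s\<in>{- 1, 1}. \<forall>c<n. h i c * h j c * h k c = s * h l c"
proof (cases "distinct [i, j, k]")
  case False
  then consider "i = j" | "i = k" | "j = k" by auto
  then show ?thesis
  proof cases
    case 1
    with assms show ?thesis by (intro exI[of _ k]) auto
  next
    case 2
    have "h k c * h j c * h k c = h j c" if "c < n" for c
      using assms sign[of k c] that by auto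
    with 2 assms show ?thesis by (intro exI[of _ j]) auto
  next
    case 3
    with assms show ?thesis by (intro exI[of _ i]) (auto simp: mult.assoc)
  qed
next
  case True
  let ?x = "\<lambda>c. h i c * h j c * h k c"
  have "?x 0 \<noteq> 0" using assms pos sign[of _ 0] by force
  then obtain l where l: "l < n" and ne: "(\<Sum>c<n. ?x c * h l c) \<noteq> 0"
    using nonorthogonal_row[of 0 ?x] pos by blast
  \<comment> \<open>Pairing the product with one of its own factors leaves the inner product of the
    other two rows, which is 0; hence \<open>l\<close> is a fourth row.\<close>
  have "(\<Sum>c<n. ?x c * h i c) = (\<Sum>c<n. h j c * h k c)"
    using assms by (intro sum.cong refl) (use sign[of i] in force)
  moreover have "(\<Sum>c<n. ?x c * h j c) = (\<Sum>c<n. h i c * h k c)"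
    using assms by (intro sum.cong refl) (use sign[of j] in force)
  moreover have "(\<Sum>c<n. ?x c * h k c) = (\<Sum>c<n. h i c * h j c)"
    using assms by (intro sum.cong refl) (use sign[of k] in force)
  ultimately have "l \<notin> {i, j, k}"
    using ne True assms by (auto simp: hadamard_row_orthogonal[OF hadamard])
  with True have "quad_profile H i j k l \<in> {0, int n}"
    using assms l by (intro quad) auto
  with ne have "\<bar>\<Sum>c<n. ?x c * h l c\<bar> = int n" by (auto simp: quad_profile_def)
  moreover have "?x c * h l c \<in> {- 1, 1}" if "c < n" for c
    using sign[OF assms(1) that] sign[OF assms(2) that] sign[OF assms(3) that] sign[OF l that]
    by auto
  ultimately obtain s where s: "s \<in> {- 1, 1}" "\<forall>c<n. ?x c * h l c = s"
    using signs_constant_if_abs_sum_eq[of n "\<lambda>c. ?x c * h l c"] by auto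
  have "?x c = s * h l c" if "c < n" for c
  proof -
    have "?x c = ?x c * (h l c * h l c)" using l that by simp
    also have "\<dots> = s * h l c" using s that by (simp add: mult.assoc[symmetric])
    finally show ?thesis .
  qed
  with l s(1) show ?thesis by blast
qed

section \<open>Growing a Sylvester structure on the rows\<close>

text \<open>The rows \<open>p u\<close>, normalised by row \<open>0\<close> and up to the signs \<open>a\<close>, are the rows of
  \<open>sylvester k\<close> with columns read through \<open>w\<close>; \<open>w\<close> is not injective in general.\<close>

definition partial_sylvester :: "nat \<Rightarrow> (nat \<Rightarrow> nat) \<Rightarrow> (nat \<Rightarrow> int) \<Rightarrow> (nat \<Rightarrow> nat) \<Rightarrow> bool" where
  "partial_sylvester k p a w \<longleftrightarrow>
     inj_on p {..<2 ^ k} \<and> p ` {..<2 ^ k} \<subseteq> {..<n} \<and> a ` {..<2 ^ k} \<subseteq> {- 1, 1} \<and>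
     w ` {..<n} \<subseteq> {..<2 ^ k} \<and>
     (\<forall>u<2 ^ k. \<forall>c<n. sylvester k $$ (u, w c) = a u * h 0 c * h (p u) c)"

lemma partial_sylvester_0: "partial_sylvester 0 (\<lambda>_. 0) (\<lambda>_. 1) (\<lambda>_. 0)"
  using pos by (auto simp: partial_sylvester_def inj_on_def)

text \<open>Row \<open>m\<close> serves as a new generator. Its triple products with row 0 and the
  old rows form the other coset, which becomes the lower half of the doubled matrix.\<close>

lemma partial_sylvester_Suc:
  assumes ps: "partial_sylvester k p a w" and m: "m < n" "m \<notin> p ` {..<2 ^ k}"
  shows "\<exists>p a w. partial_sylvester (Suc k) p a w"
proof -
  have inj: "inj_on p {..<2 ^ k}"
    and p: "\<And>u. u < 2 ^ k \<Longrightarrow> p u < n"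
    and a: "\<And>u. u < 2 ^ k \<Longrightarrow> a u \<in> {- 1, 1}"
    and w: "\<And>c. c < n \<Longrightarrow> w c < 2 ^ k"
    and S: "\<And>u c. u < 2 ^ k \<Longrightarrow> c < n \<Longrightarrow> sylvester k $$ (u, w c) = a u * h 0 c * h (p u) c"
    using ps by (auto simp: partial_sylvester_def)
  have "\<forall>u. \<exists>l s. u < 2 ^ k \<longrightarrow>
      l < n \<and> s \<in> {- 1, 1} \<and> (\<forall>c<n. h 0 c * h (p u) c * h m c = s * h l c)"
    using triple_product_row[OF pos p m(1)] by blast
  then obtain l s where l: "\<And>u. u < 2 ^ k \<Longrightarrow> l u < n"
    and s: "\<And>u. u < 2 ^ k \<Longrightarrow> s u \<in> {- 1, 1}"
    and ls: "\<And>u c. u < 2 ^ k \<Longrightarrow> c < n \<Longrightarrow> h 0 c * h (p u) c * h m c = s u * h (l u) c"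
    by metis
  define p' where "p' u = (if u < 2 ^ k then p u else l (u - 2 ^ k))" for u
  define a' where "a' u = (if u < 2 ^ k then a u else a (u - 2 ^ k) * s (u - 2 ^ k))" for u
  \<comment> \<open>The normalised generator \<open>h 0 c * h m c\<close> is the new binary digit:
    where it is -1, the column moves to the right half.\<close>
  define w' where "w' c = (if h m c = h 0 c then w c else w c + 2 ^ k)" for c
  have inj_l: "u = v" if "l u = l v" "u < 2 ^ k" "v < 2 ^ k" for u v
  proof -
    have "h (p u) c = s u * s v * h (p v) c" if c: "c < n" for c
      using ls[of u c] ls[of v c] sign[OF pos c] sign[OF m(1) c] s[of u] s[of v]
        \<open>l u = l v\<close> \<open>u < 2 ^ k\<close> \<open>v < 2 ^ k\<close> c by auto
    moreover have "s u * s v \<noteq> 0" using s that by force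
    ultimately have "p u = p v"
      using row_eq_if_proportional[OF p[OF that(2)] p[OF that(3)]] by blast
    then show ?thesis using inj that by (simp add: inj_on_eq_iff)
  qed
  \<comment> \<open>A coincidence would express row \<open>m\<close> as a signed product of row 0
    and two old rows. By closure of the Sylvester rows that is an old row \<open>p x\<close> up to
    sign, so \<open>m = p x\<close>.\<close>
  have disjoint: "l u \<noteq> p v" if uv: "u < 2 ^ k" "v < 2 ^ k" for u v
  proof
    assume eq: "l u = p v"
    obtain x where x: "x < 2 ^ k"
      and prod: "\<And>c. c < n \<Longrightarrow> sylvester k $$ (u, w c) * sylvester k $$ (v, w c) = sylvester k $$ (x, w c)"
      using sylvester_rows_closed[OF uv] w by blast
    have "h m c = (s u * a u * a v * a x) * h (p x) c" if c: "c < n" for c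
    proof -
      have "a u * h 0 c * h (p u) c * (a v * h 0 c * h (p v) c) = a x * h 0 c * h (p x) c"
        using prod[OF c] S uv x c by simp
      moreover have "h 0 c * h (p u) c * h m c = s u * h (p v) c"
        using ls[OF uv(1) c] eq by simp
      moreover have "a u * a u = 1" "a v * a v = 1"
        using a[OF uv(1)] a[OF uv(2)] by auto
      ultimately show ?thesis
        using product_relation_cancel[OF _ _ sign_square[OF pos c] sign_square[OF p[OF uv(1)] c]]
        by blast
    qed
    moreover have "s u * a u * a v * a x \<noteq> 0"
      using a[OF uv(1)] a[OF uv(2)] a[OF x] s[OF uv(1)] by auto
    ultimately have "m = p x" by (rule row_eq_if_proportional[OF m(1) p[OF x], rotated])
    then show False using m x by auto
  qed
  have "inj_on p' {..<2 ^ Suc k}"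
  proof (rule inj_onI)
    fix u v assume "u \<in> {..<2 ^ Suc k}" "v \<in> {..<2 ^ Suc k}" and eq: "p' u = p' v"
    then have uv: "u < 2 ^ Suc k" "v < 2 ^ Suc k" by auto
    from uv(1) show "u = v"
    proof (cases rule: less_power_Suc_cases)
      case 1
      from uv(2) show ?thesis
      proof (cases rule: less_power_Suc_cases)
        case v: 1
        then show ?thesis using 1 eq inj by (simp add: p'_def inj_on_eq_iff)
      next
        case (2 v')
        then show ?thesis using 1 eq disjoint[of v' u] by (simp add: p'_def)
      qed
    next
      case u: (2 u')
      from uv(2) show ?thesis
      proof (cases rule: less_power_Suc_cases)
        case 1
        then show ?thesis using u eq disjoint[of u' v] by (simp add: p'_def)
      next
        case (2 v')
        then show ?thesis using u eq inj_l[of u' v'] by (simp add: p'_def)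
      qed
    qed
  qed
  moreover have "p' u < n" "a' u \<in> {- 1, 1}" if "u < 2 ^ Suc k" for u
    using that by (cases rule: less_power_Suc_cases; use p l a s in \<open>force simp: p'_def a'_def\<close>)+
  moreover have "w' c < 2 ^ Suc k" if "c < n" for c
    using w[OF that] by (simp add: w'_def)
  moreover have "sylvester (Suc k) $$ (u, w' c) = a' u * h 0 c * h (p' u) c"
    if u: "u < 2 ^ Suc k" and c: "c < n" for u c
    using u
  proof (cases rule: less_power_Suc_cases)
    case 1
    then show ?thesis
      using w[OF c] S[OF 1 c] by (simp add: w'_def a'_def p'_def sylvester_Suc_index)
  next
    case (2 u')
    have "sylvester (Suc k) $$ (u, w' c) = sylvester k $$ (u', w c) * (h 0 c * h m c)"
      using sign[OF pos c] sign[OF m(1) c] 2 w[OF c] by (auto simp: w'_def sylvester_Suc_index)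
    also have "\<dots> = a u' * h 0 c * (h 0 c * h (p u') c * h m c)"
      using S[OF 2(1) c] by (simp add: ac_simps)
    also have "\<dots> = a' u * h 0 c * h (p' u) c"
      using 2 ls[OF 2(1) c] by (simp add: a'_def p'_def ac_simps)
    finally show ?thesis .
  qed
  ultimately have "partial_sylvester (Suc k) p' a' w'"
    unfolding partial_sylvester_def by blast
  then show ?thesis by blast
qed

section \<open>Exhausting the rows and permuting the columns\<close>

lemma partial_sylvester_le: "partial_sylvester k p a w \<Longrightarrow> 2 ^ k \<le> n"
  using card_inj_on_le[of p "{..<2 ^ k}" "{..<n}"] by (auto simp: partial_sylvester_def)

text \<open>A largest \<open>k\<close> exists because \<open>k < 2 ^ k\<close> and
  \<open>2 ^ k \<le> n\<close>; a row left over would allow one more doubling.\<close>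

lemma full_sylvester: "\<exists>k p a w. partial_sylvester k p a w \<and> p ` {..<2 ^ k} = {..<n}"
proof -
  let ?P = "\<lambda>k. \<exists>p a w. partial_sylvester k p a w"
  have bound: "k \<le> n" if "?P k" for k
    using that partial_sylvester_le less_exp[of k] by (meson less_imp_le order_trans)
  have "?P 0" using partial_sylvester_0 by blast
  then have "?P (Greatest ?P)" by (rule GreatestI_nat) (use bound in blast)
  then obtain p a w where ps: "partial_sylvester (Greatest ?P) p a w" by blast
  have "\<not> ?P (Suc (Greatest ?P))"
    using Greatest_le_nat[of ?P _ n] bound by (meson Suc_n_not_le_n)
  then have "{..<n} \<subseteq> p ` {..<2 ^ Greatest ?P}"
    using partial_sylvester_Suc[OF ps] by blast
  with ps show ?thesis by (metis (no_types, lifting) partial_sylvester_def subset_antisym)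
qed

lemma equivalent_sylvester: "\<exists>r. n = 2 ^ r \<and> hadamard_equiv H (sylvester r)"
proof -
  obtain r p a w where ps: "partial_sylvester r p a w" and onto: "p ` {..<2 ^ r} = {..<n}"
    using full_sylvester by blast
  then have inj: "inj_on p {..<2 ^ r}"
    and a: "\<And>u. u < 2 ^ r \<Longrightarrow> a u \<in> {- 1, 1}"
    and w: "w ` {..<n} \<subseteq> {..<2 ^ r}"
    and S: "\<And>u c. u < 2 ^ r \<Longrightarrow> c < n \<Longrightarrow> sylvester r $$ (u, w c) = a u * h 0 c * h (p u) c"
    by (auto simp: partial_sylvester_def)
  have n: "n = 2 ^ r" using card_image[OF inj] onto by simp
  \<comment> \<open>Two columns with the same index agree after normalisation, so they are equal or
    opposite, contradicting column orthogonality.\<close>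
  have "inj_on w {..<n}"
  proof (rule inj_onI, rule ccontr)
    fix c d assume "c \<in> {..<n}" "d \<in> {..<n}" and wcd: "w c = w d" and ne: "c \<noteq> d"
    then have cd: "c < n" "d < n" by auto
    have eq: "h i c * h i d = h 0 c * h 0 d" if "i < n" for i
    proof -
      obtain u where u: "u < 2 ^ r" "i = p u" using onto \<open>i < n\<close> by blast
      have "a u * h 0 c * h i c = a u * h 0 d * h i d"
        using S[OF u(1) cd(1)] S[OF u(1) cd(2)] wcd u(2) by metis
      then show ?thesis
        using a[OF u(1)] sign[OF pos cd(1)] sign[OF pos cd(2)] sign[OF that cd(1)] sign[OF that cd(2)]
        unfolding insert_iff empty_iff by (elim disjE) simp_all
    qed
    have "(\<Sum>i<n. h i c * h i d) = (\<Sum>i<n. h 0 c * h 0 d)"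
      by (rule sum.cong[OF refl], rule eq) simp
    moreover have "h 0 c * h 0 d \<noteq> 0" using sign[OF pos cd(1)] sign[OF pos cd(2)] by auto
    ultimately show False
      using hadamard_col_orthogonal[OF hadamard cd] ne pos by auto
  qed
  then have bij: "bij_betw w {..<n} {..<n}"
    using w endo_inj_surj[of "{..<n}" w] by (simp add: bij_betw_def n)
  define q where "q = inv_into {..<n} w"
  have q: "bij_betw q {..<n} {..<n}"
    using bij by (simp add: q_def bij_betw_inv_into)
  have wq: "w (q v) = v" if "v < n" for v
    using bij that by (simp add: q_def bij_betw_inv_into_right)
  have qn: "q v < n" if "v < n" for v
    using q that by (auto simp: bij_betw_def)
  have "hadamard_equiv H (sylvester r)"
  proof (rule hadamard_equiv_signed_permutations)
    show "H \<in> carrier_mat n n" by auto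
    show "sylvester r \<in> carrier_mat n n" by (simp add: n)
    show "bij_betw p {..<n} {..<n}" using inj onto by (simp add: bij_betw_def n)
    show "a u \<in> {- 1, 1}" if "u < n" for u using a that n by blast
    \<comment> \<open>The column signs are the entries of row 0, undoing the normalisation by that
      row.\<close>
    show "h 0 (q v) \<in> {- 1, 1}" if "v < n" for v using sign[OF pos] qn that by blast
    show "sylvester r $$ (u, v) = a u * h 0 (q v) * h (p u) (q v)" if "u < n" "v < n" for u v
      using S[of u "q v"] that wq qn n by simp
  qed (rule q)
  with n show ?thesis by blast
qed

end

theorem theorem3p6:
  fixes t :: nat and H :: "int mat"
  assumes "t > 0"
    and "hadamard_mat (8 * t) H"
    and "\<And>i j k l. \<lbrakk>i < 8 * t; j < 8 * t; k < 8 * t; l < 8 * t; distinct [i, j, k, l]\<rbrakk>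
           \<Longrightarrow> quad_type H i j k l \<in> {0, of_nat t}"
  shows "\<exists>r. 8 * t = 2 ^ r \<and> hadamard_equiv H (sylvester r)"
proof -
  have dim: "dim_col H = 8 * t" using assms(2) by (auto simp: hadamard_mat_def)
  \<comment> \<open>Type 0 corresponds to profile \<open>8 * t\<close>, and type \<open>t\<close> to
    profile 0.\<close>
  have "quad_profile H i j k l \<in> {0, int (8 * t)}"
    if "quad_type H i j k l \<in> {0, of_nat t}" for i j k l
  proof -
    from that have "rat_of_int (quad_profile H i j k l) = of_int (int (8 * t)) \<or>
        rat_of_int (quad_profile H i j k l) = of_int 0"
      by (auto simp: quad_type_def dim field_simps)
    then show ?thesis by (simp only: of_int_eq_iff) auto
  qed
  then interpret extremal_quadruples "8 * t" H
    by unfold_locales (use assms in auto)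
  show ?thesis by (rule equivalent_sylvester)
qed

end
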